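(* Let $k$ be a field, $f:\Pi\to\Lambda$ an order preserving map of finite posets, and $(I^\bullet,\eta^\bullet)$ a (bounded) injective complex on $\Pi$ represented by labeled matrices. Then $\mathcal{I}f_*I^\bullet$ is obtained by performing the following two steps: 1. change every label $\pi$ to $f(\pi)$ in all matrices $\eta^d$; 2. minimize the resulting complex of $\Lambda$-labeled matrices, i.e. replace it by the minimal injective complex on $\Lambda$ quasi-isomorphic to the complex it represents. One obtains $\mathcal{I}f_*I^\bullet$ in this way regardless of whether $I^\bullet$ is minimal to start with.
   Context: A sheaf on a finite poset is a functor to finite-dimensional $k$-vector spaces. $\mathrm{St}\,\pi=\{\tau:\pi\le\tau\}$. $[\pi]$ is the sheaf with $[\pi](\sigma)=k$ for $\sigma\le\pi$ and $0$ otherwise (identity maps between copies of $k$); injective sheaves are exactly the sheaves isomorphic to finite direct sums of these. A complex of injective sheaves is minimal if in each degree its number of indecomposable summands is least among all bounded complexes of injective sheaves quasi-isomorphic to it; every bounded complex of sheaves is quasi-isomorphic to a minimal injective complex (its minimal injective resolution), unique up to isomorphism. A $\Pi$-labeled matrix is a matrix over $k$ with each row and column labeled by an element of $\Pi$ (repetitions allowed), such that the entry in a row labeled $\sigma$ and column labeled $\pi$ is nonzero only if $\sigma\le\pi$. With column labels $\pi_1,\dots,\pi_m$ and row labels $\sigma_1,\dots,\sigma_n$ it represents the natural transformation $\bigoplus_i[\pi_i]\to\bigoplus_j[\sigma_j]$ whose component at $\tau$ is the submatrix on rows and columns with labels in $\mathrm{St}\,\tau$. A complex of labeled matrices (columns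 of $\eta^{d+1}$ labeled as the rows of $\eta^d$, $\eta^{d+1}\eta^d=0$) represents the corresponding injective complex. The pushforward of a sheaf $F$ on $\Pi$ is the sheaf on $\Lambda$ given by $f_*F(\lambda)=\varprojlim_{\pi\in f^{-1}(\mathrm{St}\,\lambda)}F(\pi)$, with the natural restriction maps; it is functorial and is applied to complexes degreewise. $\mathcal{I}f_*I^\bullet$ denotes the minimal injective resolution of $f_*I^\bullet$, considered up to isomorphism of complexes. *)

theory Defs
  imports "HOL-Library.Function_Algebras" "Jordan_Normal_Form.Matrix"
begin

text \<open>
  A finite poset is a finite subset \<open>P\<close> of a type of class \<open>order\<close> with the induced order.
  A finite-dimensional vector space over \<open>'k\<close> is a finite-dimensional subspace of a function
  space \<open>'i \<Rightarrow> 'k\<close>. For \<open>'i = nat\<close> every finite-dimensional space occurs up to isomorphism, so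
  quantification over all complexes of sheaves is quantification over those with \<open>'i = nat\<close>.
  The index type is left variable because a limit of spaces in \<open>'i \<Rightarrow> 'k\<close> over a diagram
  indexed by \<open>'p\<close> naturally lives in \<open>'p \<times> 'i \<Rightarrow> 'k\<close>.
\<close>

definition fscale :: "'k::field \<Rightarrow> ('i \<Rightarrow> 'k) \<Rightarrow> ('i \<Rightarrow> 'k)" where
  "fscale c v = (\<lambda>i. c * v i)"

global_interpretation fun_space: vector_space "fscale :: 'k::field \<Rightarrow> ('i \<Rightarrow> 'k) \<Rightarrow> _"
  by unfold_locales (auto simp: fscale_def fun_eq_iff algebra_simps)

definition fd_space :: "('i \<Rightarrow> 'k::field) set \<Rightarrow> bool" where
  "fd_space V \<longleftrightarrow> fun_space.subspace V \<and> (\<exists>B. finite B \<and> V = fun_space.span B)"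

definition linear_map ::
    "('i \<Rightarrow> 'k::field) set \<Rightarrow> ('j \<Rightarrow> 'k) set \<Rightarrow> (('i \<Rightarrow> 'k) \<Rightarrow> ('j \<Rightarrow> 'k)) \<Rightarrow> bool" where
  "linear_map V W g \<longleftrightarrow>
     g \<in> V \<rightarrow> W \<and>
     (\<forall>u\<in>V. \<forall>v\<in>V. g (u + v) = g u + g v) \<and>
     (\<forall>c. \<forall>v\<in>V. g (fscale c v) = fscale c (g v))"


section \<open>Sheaves on a finite poset\<close>

text \<open>\<open>res F \<sigma> \<tau>\<close> is the structure map \<open>F(\<sigma>) \<rightarrow> F(\<tau>)\<close> for \<open>\<sigma> \<le> \<tau>\<close>. Values of all maps
  outside the poset, outside the stalks, or on incomparable pairs are irrelevant.\<close>

record ('p, 'i, 'k) sheaf =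
  stalk :: "'p \<Rightarrow> ('i \<Rightarrow> 'k) set"
  res :: "'p \<Rightarrow> 'p \<Rightarrow> ('i \<Rightarrow> 'k) \<Rightarrow> ('i \<Rightarrow> 'k)"

definition is_sheaf :: "'p::order set \<Rightarrow> ('p, 'i, 'k::field) sheaf \<Rightarrow> bool" where
  "is_sheaf P F \<longleftrightarrow>
     (\<forall>\<sigma>\<in>P. fd_space (stalk F \<sigma>)) \<and>
     (\<forall>\<sigma>\<in>P. \<forall>\<tau>\<in>P. \<sigma> \<le> \<tau> \<longrightarrow> linear_map (stalk F \<sigma>) (stalk F \<tau>) (res F \<sigma> \<tau>)) \<and>
     (\<forall>\<sigma>\<in>P. \<forall>v\<in>stalk F \<sigma>. res F \<sigma> \<sigma> v = v) \<and>
     (\<forall>\<rho>\<in>P. \<forall>\<sigma>\<in>P. \<forall>\<tau>\<in>P. \<rho> \<le> \<sigma> \<longrightarrow> \<sigma> \<le> \<tau> \<longrightarrow>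
        (\<forall>v\<in>stalk F \<rho>. res F \<sigma> \<tau> (res F \<rho> \<sigma> v) = res F \<rho> \<tau> v))"

type_synonym ('p, 'i, 'j, 'k) sheaf_map = "'p \<Rightarrow> ('i \<Rightarrow> 'k) \<Rightarrow> ('j \<Rightarrow> 'k)"

definition sheaf_hom ::
    "'p::order set \<Rightarrow> ('p, 'i, 'k::field) sheaf \<Rightarrow> ('p, 'j, 'k) sheaf \<Rightarrow>
     ('p, 'i, 'j, 'k) sheaf_map \<Rightarrow> bool" where
  "sheaf_hom P F G \<phi> \<longleftrightarrow>
     (\<forall>\<sigma>\<in>P. linear_map (stalk F \<sigma>) (stalk G \<sigma>) (\<phi> \<sigma>)) \<and>
     (\<forall>\<sigma>\<in>P. \<forall>\<tau>\<in>P. \<sigma> \<le> \<tau> \<longrightarrow>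
        (\<forall>v\<in>stalk F \<sigma>. \<phi> \<tau> (res F \<sigma> \<tau> v) = res G \<sigma> \<tau> (\<phi> \<sigma> v)))"

definition sheaves_isomorphic ::
    "'p::order set \<Rightarrow> ('p, 'i, 'k::field) sheaf \<Rightarrow> ('p, 'j, 'k) sheaf \<Rightarrow> bool" where
  "sheaves_isomorphic P F G \<longleftrightarrow>
     is_sheaf P F \<and> is_sheaf P G \<and>
     (\<exists>\<phi>. sheaf_hom P F G \<phi> \<and> (\<forall>\<sigma>\<in>P. bij_betw (\<phi> \<sigma>) (stalk F \<sigma>) (stalk G \<sigma>)))"

text \<open>The direct sum \<open>[\<pi>\<^sub>0] \<oplus> \<dots> \<oplus> [\<pi>\<^sub>m\<^sub>-\<^sub>1]\<close> for the list \<open>ps = [\<pi>\<^sub>0, \<dots>, \<pi>\<^sub>m\<^sub>-\<^sub>1]\<close>: coordinate \<open>i\<close> belongs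
  to the summand \<open>[\<pi>\<^sub>i]\<close>. The structure map \<open>\<sigma> \<rightarrow> \<tau>\<close> keeps the coordinates with \<open>\<tau> \<le> \<pi>\<^sub>i\<close> and
  kills the others.\<close>

definition injective_sum :: "'p::order list \<Rightarrow> ('p, nat, 'k::field) sheaf" where
  "injective_sum ps = \<lparr>
     stalk = (\<lambda>\<tau>. {v. \<forall>i. v i \<noteq> 0 \<longrightarrow> i < length ps \<and> \<tau> \<le> ps ! i}),
     res = (\<lambda>\<sigma> \<tau> v i. if i < length ps \<and> \<tau> \<le> ps ! i then v i else 0) \<rparr>"

definition has_summands :: "'p::order set \<Rightarrow> ('p, 'i, 'k::field) sheaf \<Rightarrow> 'p list \<Rightarrow> bool" where
  "has_summands P F ps \<longleftrightarrow>
     set ps \<subseteq> P \<and> sheaves_isomorphic P F (injective_sum ps :: ('p, nat, 'k) sheaf)"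

definition injective_sheaf :: "'p::order set \<Rightarrow> ('p, 'i, 'k::field) sheaf \<Rightarrow> bool" where
  "injective_sheaf P F \<longleftrightarrow> (\<exists>ps. has_summands P F ps)"


section \<open>Complexes of sheaves\<close>

record ('p, 'i, 'k) sheaf_complex =
  obj :: "int \<Rightarrow> ('p, 'i, 'k) sheaf"
  diff :: "int \<Rightarrow> ('p, 'i, 'i, 'k) sheaf_map"

definition is_complex :: "'p::order set \<Rightarrow> ('p, 'i, 'k::field) sheaf_complex \<Rightarrow> bool" where
  "is_complex P X \<longleftrightarrow>
     (\<forall>d. is_sheaf P (obj X d)) \<and>
     (\<forall>d. sheaf_hom P (obj X d) (obj X (d + 1)) (diff X d)) \<and>
     (\<forall>d. \<forall>\<sigma>\<in>P. \<forall>v\<in>stalk (obj X d) \<sigma>. diff X (d + 1) \<sigma> (diff X d \<sigma> v) = 0)"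

definition bounded_complex :: "'p::order set \<Rightarrow> ('p, 'i, 'k::field) sheaf_complex \<Rightarrow> bool" where
  "bounded_complex P X \<longleftrightarrow>
     is_complex P X \<and> finite {d. \<exists>\<sigma>\<in>P. stalk (obj X d) \<sigma> \<noteq> {0}}"

definition chain_map ::
    "'p::order set \<Rightarrow> ('p, 'i, 'k::field) sheaf_complex \<Rightarrow> ('p, 'j, 'k) sheaf_complex \<Rightarrow>
     (int \<Rightarrow> ('p, 'i, 'j, 'k) sheaf_map) \<Rightarrow> bool" where
  "chain_map P X Y \<phi> \<longleftrightarrow>
     (\<forall>d. sheaf_hom P (obj X d) (obj Y d) (\<phi> d)) \<and>
     (\<forall>d. \<forall>\<sigma>\<in>P. \<forall>v\<in>stalk (obj X d) \<sigma>. \<phi> (d + 1) \<sigma> (diff X d \<sigma> v) = diff Y d \<sigma> (\<phi> d \<sigma> v))"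

definition complexes_isomorphic ::
    "'p::order set \<Rightarrow> ('p, 'i, 'k::field) sheaf_complex \<Rightarrow> ('p, 'j, 'k) sheaf_complex \<Rightarrow> bool" where
  "complexes_isomorphic P X Y \<longleftrightarrow>
     is_complex P X \<and> is_complex P Y \<and>
     (\<exists>\<phi>. chain_map P X Y \<phi> \<and>
        (\<forall>d. \<forall>\<sigma>\<in>P. bij_betw (\<phi> d \<sigma>) (stalk (obj X d) \<sigma>) (stalk (obj Y d) \<sigma>)))"

text \<open>Kernels, images and quotients in the functor category are computed stalkwise, so
  \<open>cohomology X d \<sigma>\<close> is the stalk at \<open>\<sigma>\<close> of the cohomology sheaf \<open>H\<^sup>d(X)\<close>, and a map of sheaves is
  an isomorphism iff it is bijective on all stalks. An element of \<open>cohomology X d \<sigma>\<close> is a coset of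
  the coboundaries; \<open>induced_map\<close> sends the coset of \<open>z\<close> to the coset of \<open>\<phi> z\<close>.\<close>

definition cocycles :: "('p, 'i, 'k::field) sheaf_complex \<Rightarrow> int \<Rightarrow> 'p \<Rightarrow> ('i \<Rightarrow> 'k) set" where
  "cocycles X d \<sigma> = {v \<in> stalk (obj X d) \<sigma>. diff X d \<sigma> v = 0}"

definition coboundaries :: "('p, 'i, 'k::field) sheaf_complex \<Rightarrow> int \<Rightarrow> 'p \<Rightarrow> ('i \<Rightarrow> 'k) set" where
  "coboundaries X d \<sigma> = diff X (d - 1) \<sigma> ` stalk (obj X (d - 1)) \<sigma>"

definition cohomologous ::
    "('p, 'i, 'k::field) sheaf_complex \<Rightarrow> int \<Rightarrow> 'p \<Rightarrow> (('i \<Rightarrow> 'k) \<times> ('i \<Rightarrow> 'k)) set" where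
  "cohomologous X d \<sigma> =
     {(u, v). u \<in> cocycles X d \<sigma> \<and> v \<in> cocycles X d \<sigma> \<and> u - v \<in> coboundaries X d \<sigma>}"

definition cohomology :: "('p, 'i, 'k::field) sheaf_complex \<Rightarrow> int \<Rightarrow> 'p \<Rightarrow> ('i \<Rightarrow> 'k) set set" where
  "cohomology X d \<sigma> = cocycles X d \<sigma> // cohomologous X d \<sigma>"

definition induced_map ::
    "('p, 'j, 'k::field) sheaf_complex \<Rightarrow> (int \<Rightarrow> ('p, 'i, 'j, 'k) sheaf_map) \<Rightarrow> int \<Rightarrow> 'p \<Rightarrow>
     ('i \<Rightarrow> 'k) set \<Rightarrow> ('j \<Rightarrow> 'k) set" where
  "induced_map Y \<phi> d \<sigma> C = cohomologous Y d \<sigma> `` (\<phi> d \<sigma> ` C)"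

definition quasi_isomorphism ::
    "'p::order set \<Rightarrow> ('p, 'i, 'k::field) sheaf_complex \<Rightarrow> ('p, 'j, 'k) sheaf_complex \<Rightarrow>
     (int \<Rightarrow> ('p, 'i, 'j, 'k) sheaf_map) \<Rightarrow> bool" where
  "quasi_isomorphism P X Y \<phi> \<longleftrightarrow>
     chain_map P X Y \<phi> \<and>
     (\<forall>d. \<forall>\<sigma>\<in>P. bij_betw (induced_map Y \<phi> d \<sigma>) (cohomology X d \<sigma>) (cohomology Y d \<sigma>))"

text \<open>Two bounded complexes are quasi-isomorphic if they are connected by a zigzag of
  quasi-isomorphisms. The zigzag lives in index type \<open>nat\<close>; the isomorphisms at its ends
  only transport \<open>X\<close> and \<open>Y\<close> into that index type.\<close>

definition qis_step ::
    "'p::order set \<Rightarrow> ('p, nat, 'k::field) sheaf_complex \<Rightarrow> ('p, nat, 'k) sheaf_complex \<Rightarrow> bool" where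
  "qis_step P A B \<longleftrightarrow>
     bounded_complex P A \<and> bounded_complex P B \<and> (\<exists>\<phi>. quasi_isomorphism P A B \<phi>)"

definition quasi_isomorphic ::
    "'p::order set \<Rightarrow> ('p, 'i, 'k::field) sheaf_complex \<Rightarrow> ('p, 'j, 'k) sheaf_complex \<Rightarrow> bool" where
  "quasi_isomorphic P X Y \<longleftrightarrow>
     bounded_complex P X \<and> bounded_complex P Y \<and>
     (\<exists>A B :: ('p, nat, 'k) sheaf_complex.
        complexes_isomorphic P X A \<and> equivclp (qis_step P) A B \<and> complexes_isomorphic P B Y)"

definition injective_complex :: "'p::order set \<Rightarrow> ('p, 'i, 'k::field) sheaf_complex \<Rightarrow> bool" where
  "injective_complex P X \<longleftrightarrow> bounded_complex P X \<and> (\<forall>d. injective_sheaf P (obj X d))"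

text \<open>The number of indecomposable summands in degree \<open>d\<close> is the length of a list \<open>ps\<close> with
  \<open>has_summands P (obj X d) ps\<close> (each \<open>[\<pi>]\<close> is indecomposable).\<close>

definition minimal_injective_complex ::
    "'p::order set \<Rightarrow> ('p, 'i, 'k::field) sheaf_complex \<Rightarrow> bool" where
  "minimal_injective_complex P J \<longleftrightarrow>
     injective_complex P J \<and>
     (\<forall>K :: ('p, nat, 'k) sheaf_complex.
        injective_complex P K \<longrightarrow> quasi_isomorphic P K J \<longrightarrow>
        (\<forall>d ps qs. has_summands P (obj J d) ps \<longrightarrow> has_summands P (obj K d) qs \<longrightarrow>
           length ps \<le> length qs))"

text \<open>The minimal injective resolution is only determined up to isomorphism of complexes, so it is
  described by the predicate ``\<open>J\<close> is a minimal injective resolution of \<open>X\<close>'', which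
  holds for the members of a single isomorphism class.\<close>

definition minimal_injective_resolution ::
    "'p::order set \<Rightarrow> ('p, 'i, 'k::field) sheaf_complex \<Rightarrow> ('p, 'j, 'k) sheaf_complex \<Rightarrow> bool" where
  "minimal_injective_resolution P X J \<longleftrightarrow>
     minimal_injective_complex P J \<and> quasi_isomorphic P X J"


section \<open>Complexes of labeled matrices\<close>

definition labeled_matrix ::
    "'p::order set \<Rightarrow> 'p list \<Rightarrow> 'p list \<Rightarrow> 'k::field mat \<Rightarrow> bool" where
  "labeled_matrix P rs cs A \<longleftrightarrow>
     set rs \<subseteq> P \<and> set cs \<subseteq> P \<and> A \<in> carrier_mat (length rs) (length cs) \<and>
     (\<forall>i<length rs. \<forall>j<length cs. A $$ (i, j) \<noteq> 0 \<longrightarrow> rs ! i \<le> cs ! j)"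

text \<open>\<open>labels M d\<close> labels the columns of \<open>matrices M d\<close> and the rows of \<open>matrices M (d - 1)\<close>.\<close>

record ('p, 'k) matrix_complex =
  labels :: "int \<Rightarrow> 'p list"
  matrices :: "int \<Rightarrow> 'k mat"

definition labeled_matrix_complex ::
    "'p::order set \<Rightarrow> ('p, 'k::field) matrix_complex \<Rightarrow> bool" where
  "labeled_matrix_complex P M \<longleftrightarrow>
     (\<forall>d. labeled_matrix P (labels M (d + 1)) (labels M d) (matrices M d)) \<and>
     (\<forall>d. matrices M (d + 1) * matrices M d =
        0\<^sub>m (length (labels M (d + 2))) (length (labels M d))) \<and>
     finite {d. labels M d \<noteq> []}"

text \<open>The component at \<open>\<tau>\<close> multiplies by the submatrix on the rows and columns with label \<open>\<ge> \<tau>\<close>.\<close>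

definition matrix_map ::
    "'p::order list \<Rightarrow> 'p list \<Rightarrow> 'k::field mat \<Rightarrow> ('p, nat, nat, 'k) sheaf_map" where
  "matrix_map rs cs A = (\<lambda>\<tau> v i.
     if i < length rs \<and> \<tau> \<le> rs ! i
     then \<Sum>j \<in> {j. j < length cs \<and> \<tau> \<le> cs ! j}. A $$ (i, j) * v j
     else 0)"

definition represented_complex ::
    "('p::order, 'k::field) matrix_complex \<Rightarrow> ('p, nat, 'k) sheaf_complex" where
  "represented_complex M = \<lparr>
     obj = (\<lambda>d. injective_sum (labels M d)),
     diff = (\<lambda>d. matrix_map (labels M (d + 1)) (labels M d) (matrices M d)) \<rparr>"

definition represents ::
    "'p::order set \<Rightarrow> ('p, 'k::field) matrix_complex \<Rightarrow> ('p, 'i, 'k) sheaf_complex \<Rightarrow> bool" where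
  "represents P M X \<longleftrightarrow>
     labeled_matrix_complex P M \<and> complexes_isomorphic P X (represented_complex M)"

definition relabel ::
    "('p \<Rightarrow> 'l) \<Rightarrow> ('p, 'k) matrix_complex \<Rightarrow> ('l, 'k) matrix_complex" where
  "relabel f M = \<lparr> labels = (\<lambda>d. map f (labels M d)), matrices = matrices M \<rparr>"


section \<open>Pushforward\<close>

text \<open>The limit of \<open>F\<close> over \<open>f\<^sup>-\<^sup>1(St \<lambda>)\<close> is the space of compatible families. Such a family is
  stored as a function \<open>s\<close> on \<open>'p \<times> 'i\<close> whose member at \<open>\<pi>\<close> is \<open>curry s \<pi>\<close>, extended by \<open>0\<close> to
  all \<open>\<pi>\<close> outside \<open>f\<^sup>-\<^sup>1(St \<lambda>)\<close>.\<close>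

definition star_preimage :: "'p::order set \<Rightarrow> ('p \<Rightarrow> 'l::order) \<Rightarrow> 'l \<Rightarrow> 'p set" where
  "star_preimage P f l = {\<pi> \<in> P. l \<le> f \<pi>}"

definition pushforward ::
    "'p::order set \<Rightarrow> ('p \<Rightarrow> 'l::order) \<Rightarrow> ('p, 'i, 'k::field) sheaf \<Rightarrow> ('l, 'p \<times> 'i, 'k) sheaf" where
  "pushforward P f F = \<lparr>
     stalk = (\<lambda>l. {s.
       (\<forall>\<pi>\<in>star_preimage P f l. curry s \<pi> \<in> stalk F \<pi>) \<and>
       (\<forall>\<pi>\<in>star_preimage P f l. \<forall>\<rho>\<in>star_preimage P f l. \<pi> \<le> \<rho> \<longrightarrow>
          res F \<pi> \<rho> (curry s \<pi>) = curry s \<rho>) \<and>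
       (\<forall>\<pi>. \<pi> \<notin> star_preimage P f l \<longrightarrow> curry s \<pi> = 0)}),
     res = (\<lambda>l l' s (\<pi>, i). if \<pi> \<in> star_preimage P f l' then s (\<pi>, i) else 0) \<rparr>"

definition pushforward_map ::
    "'p::order set \<Rightarrow> ('p \<Rightarrow> 'l::order) \<Rightarrow> ('p, 'i, 'j, 'k::field) sheaf_map \<Rightarrow>
     ('l, 'p \<times> 'i, 'p \<times> 'j, 'k) sheaf_map" where
  "pushforward_map P f \<phi> = (\<lambda>l s (\<pi>, i). if \<pi> \<in> star_preimage P f l then \<phi> \<pi> (curry s \<pi>) i else 0)"

definition pushforward_complex ::
    "'p::order set \<Rightarrow> ('p \<Rightarrow> 'l::order) \<Rightarrow> ('p, 'i, 'k::field) sheaf_complex \<Rightarrow>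
     ('l, 'p \<times> 'i, 'k) sheaf_complex" where
  "pushforward_complex P f X = \<lparr>
     obj = (\<lambda>d. pushforward P f (obj X d)),
     diff = (\<lambda>d. pushforward_map P f (diff X d)) \<rparr>"

end

theory Submission
  imports Defs
begin

text \<open>
  A section of \<open>f\<^sub>*[\<pi>]\<close> over \<open>\<lambda>\<close> is a compatible family on the points of \<open>f\<^sup>-\<^sup>1(St \<lambda>)\<close> below \<open>\<pi>\<close>, and
  it is determined by its value at \<open>\<pi>\<close>, which is unconstrained if \<open>\<lambda> \<le> f \<pi>\<close>. So \<open>f\<^sub>*[\<pi>] = [f \<pi>]\<close>.
  Evaluating the \<open>i\<close>-th coordinate of a family at the \<open>i\<close>-th label identifies the pushforward of a
  represented complex with the complex represented by the relabeled matrices: an isomorphism of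
  complexes, not just a quasi-isomorphism. Quasi-isomorphism classes are invariant under
  isomorphism, so both complexes have the same minimal injective resolutions.
\<close>

section \<open>Linear maps\<close>

lemma fscale_apply: "fscale c v i = c * v i"
  by (simp add: fscale_def)

lemma linear_mapD:
  assumes "linear_map V W g"
  shows "v \<in> V \<Longrightarrow> g v \<in> W"
    and "u \<in> V \<Longrightarrow> v \<in> V \<Longrightarrow> g (u + v) = g u + g v"
    and "v \<in> V \<Longrightarrow> g (fscale c v) = fscale c (g v)"
  using assms by (auto simp: linear_map_def)

lemma fd_space_subspace: "fd_space V \<Longrightarrow> fun_space.subspace V"
  by (simp add: fd_space_def)

lemma linear_map_zero:
  assumes "linear_map V W g" "fun_space.subspace V"
  shows "g 0 = 0"
proof -
  have "0 \<in> V" using assms(2) by (rule fun_space.subspace_0)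
  then have "g (fscale 0 0) = fscale 0 (g 0)" by (rule linear_mapD(3)[OF assms(1)])
  then show ?thesis by simp
qed

lemma linear_map_compose:
  assumes "linear_map U V g" "linear_map V W h"
  shows "linear_map U W (\<lambda>x. h (g x))"
  using assms by (auto simp: linear_map_def Pi_iff)

text \<open>Both laws are checked after applying \<open>g\<close>, which is injective on
  \<open>V\<close>; since \<open>V\<close> is a subspace, the candidate sum and multiple lie where
  injectivity applies.\<close>

lemma linear_map_inv_into:
  assumes g: "linear_map V W g" and V: "fun_space.subspace V" and b: "bij_betw g V W"
  shows "linear_map W V (inv_into V g)"
proof -
  note inv = bij_betw_inv_into_left[OF b] and inv' = bij_betw_inv_into_right[OF b]
  have mem: "inv_into V g w \<in> V" if "w \<in> W" for w
    using b that by (metis bij_betw_imp_surj_on inv_into_into)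
  have "inv_into V g (u + w) = inv_into V g u + inv_into V g w" if "u \<in> W" "w \<in> W" for u w
  proof -
    have "g (inv_into V g u + inv_into V g w) = u + w"
      using that mem inv' linear_mapD(2)[OF g] by simp
    then show ?thesis
      using inv fun_space.subspace_add[OF V mem mem] that by metis
  qed
  moreover have "inv_into V g (fscale c w) = fscale c (inv_into V g w)" if "w \<in> W" for c w
  proof -
    have "g (fscale c (inv_into V g w)) = fscale c w"
      using that mem inv' linear_mapD(3)[OF g] by simp
    then show ?thesis
      using inv fun_space.subspace_scale[OF V mem] that by metis
  qed
  ultimately show ?thesis using mem by (auto simp: linear_map_def)
qed

text \<open>Images of generators generate the image. This later transports finite-dimensionality to
  the stalks of a pushforward.\<close>

lemma fd_space_linear_image:
  assumes V: "fd_space V" and g: "linear_map V W g"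
  shows "fd_space (g ` V)"
proof -
  note sub = fd_space_subspace[OF V]
  obtain B where B: "finite B" "V = fun_space.span B"
    using V by (auto simp: fd_space_def)
  have image: "fun_space.subspace (g ` V)"
    unfolding fun_space.subspace_def
  proof (intro conjI ballI allI)
    show "0 \<in> g ` V"
      using linear_map_zero[OF g sub] fun_space.subspace_0[OF sub] by force
  next
    fix x y assume "x \<in> g ` V" "y \<in> g ` V"
    then obtain u v where "u \<in> V" "v \<in> V" "x = g u" "y = g v" by blast
    then show "x + y \<in> g ` V"
      using linear_mapD(2)[OF g] fun_space.subspace_add[OF sub] by (metis imageI)
  next
    fix c x assume "x \<in> g ` V"
    then obtain u where "u \<in> V" "x = g u" by blast
    then show "fscale c x \<in> g ` V"
      using linear_mapD(3)[OF g] fun_space.subspace_scale[OF sub] by (metis imageI)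
  qed
  \<comment> \<open>\<open>g\<close> is linear only on \<open>V\<close>, so the span induction
    carries \<open>v \<in> V\<close> along with the claim.\<close>
  have "v \<in> V \<and> g v \<in> fun_space.span (g ` B)" if "v \<in> fun_space.span B" for v
    using that
  proof (induction rule: fun_space.span_induct_alt)
    case base
    show ?case
      unfolding linear_map_zero[OF g sub]
      using fun_space.subspace_0[OF sub] fun_space.span_zero by blast
  next
    case (step c x y)
    have x: "fscale c x \<in> V" "x \<in> V"
      using step(1) B(2) fun_space.span_base fun_space.subspace_scale[OF sub] by blast+
    then have "g (fscale c x + y) = fscale c (g x) + g y"
      using linear_mapD(2,3)[OF g] step(2) by simp
    moreover have "g x \<in> fun_space.span (g ` B)"
      using step(1) by (simp add: fun_space.span_base)
    ultimately show ?case
      using step(2) x fun_space.subspace_add[OF sub] fun_space.span_add fun_space.span_scale by metis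
  qed
  moreover have "fun_space.span (g ` B) \<subseteq> g ` V"
    using image B(2) by (intro fun_space.span_minimal) (auto intro: fun_space.span_base)
  ultimately have "g ` V = fun_space.span (g ` B)" using B(2) by auto
  then show ?thesis using image B(1) by (auto simp: fd_space_def)
qed

text \<open>The delta functions \<open>e j\<close> with \<open>j \<in> S\<close> span. Stalks of an
  injective sum have exactly this shape.\<close>

lemma fd_space_finite_support:
  fixes S :: "'i set"
  assumes "finite S"
  shows "fd_space {v :: 'i \<Rightarrow> 'k::field. \<forall>i. v i \<noteq> 0 \<longrightarrow> i \<in> S}" (is "fd_space ?V")
proof -
  define e :: "'i \<Rightarrow> 'i \<Rightarrow> 'k" where "e j = (\<lambda>i. if i = j then 1 else 0)" for j
  have sub: "fun_space.subspace ?V"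
    by (auto simp: fun_space.subspace_def fscale_apply) (metis add_0)
  have "v \<in> fun_space.span (e ` S)" if "v \<in> ?V" for v
  proof -
    \<comment> \<open>The induction runs over \<open>T\<close> with \<open>v\<close> fixed; the
      support of \<open>v\<close> matters only afterwards, for \<open>T = S\<close>.\<close>
    have "(\<Sum>j\<in>T. fscale (v j) (e j)) i = (if i \<in> T then v i else 0)" if "finite T" for T i
      using that by (induction T) (auto simp: e_def fscale_apply)
    then have "v = (\<Sum>j\<in>S. fscale (v j) (e j))"
      using \<open>v \<in> ?V\<close> assms by (auto simp: fun_eq_iff)
    also have "\<dots> \<in> fun_space.span (e ` S)"
      by (intro fun_space.span_sum fun_space.span_scale fun_space.span_base) auto
    finally show ?thesis .
  qed
  moreover have "fun_space.span (e ` S) \<subseteq> ?V"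
    using sub by (intro fun_space.span_minimal) (auto simp: e_def split: if_splits)
  ultimately have "?V = fun_space.span (e ` S)" by auto
  then show ?thesis using sub assms by (auto simp: fd_space_def)
qed

lemma sheaf_hom_mem:
  assumes "sheaf_hom P F G \<phi>" "\<sigma> \<in> P" "v \<in> stalk F \<sigma>"
  shows "\<phi> \<sigma> v \<in> stalk G \<sigma>"
  using assms linear_mapD(1) unfolding sheaf_hom_def by blast

lemma res_mem:
  assumes "is_sheaf P F" "\<sigma> \<in> P" "\<tau> \<in> P" "\<sigma> \<le> \<tau>" "v \<in> stalk F \<sigma>"
  shows "res F \<sigma> \<tau> v \<in> stalk F \<tau>"
  using assms linear_mapD(1) unfolding is_sheaf_def by blast

section \<open>Isomorphisms of complexes\<close>

lemma complexes_isomorphic_sym: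
  assumes "complexes_isomorphic P X Y"
  shows "complexes_isomorphic P Y X"
proof -
  from assms obtain \<phi> where X: "is_complex P X" and Y: "is_complex P Y"
    and \<phi>: "chain_map P X Y \<phi>"
    and b: "\<And>d \<sigma>. \<sigma> \<in> P \<Longrightarrow> bij_betw (\<phi> d \<sigma>) (stalk (obj X d) \<sigma>) (stalk (obj Y d) \<sigma>)"
    by (auto simp: complexes_isomorphic_def)
  define \<psi> where "\<psi> d \<sigma> = inv_into (stalk (obj X d) \<sigma>) (\<phi> d \<sigma>)" for d \<sigma>
  have inv: "\<psi> d \<sigma> (\<phi> d \<sigma> v) = v" if "\<sigma> \<in> P" "v \<in> stalk (obj X d) \<sigma>" for d \<sigma> v
    unfolding \<psi>_def using bij_betw_inv_into_left[OF b] that by blast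
  have inv': "\<phi> d \<sigma> (\<psi> d \<sigma> w) = w" if "\<sigma> \<in> P" "w \<in> stalk (obj Y d) \<sigma>" for d \<sigma> w
    unfolding \<psi>_def using bij_betw_inv_into_right[OF b] that by blast
  have bij: "bij_betw (\<psi> d \<sigma>) (stalk (obj Y d) \<sigma>) (stalk (obj X d) \<sigma>)" if "\<sigma> \<in> P" for d \<sigma>
    unfolding \<psi>_def using bij_betw_inv_into[OF b] that by blast
  have mem: "\<psi> d \<sigma> w \<in> stalk (obj X d) \<sigma>" if "\<sigma> \<in> P" "w \<in> stalk (obj Y d) \<sigma>" for d \<sigma> w
    using bij_betw_apply[OF bij] that by blast
  have "sheaf_hom P (obj Y d) (obj X d) (\<psi> d)" for d
    unfolding sheaf_hom_def
  proof (intro conjI ballI impI)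
    fix \<sigma> assume "\<sigma> \<in> P"
    then show "linear_map (stalk (obj Y d) \<sigma>) (stalk (obj X d) \<sigma>) (\<psi> d \<sigma>)"
      unfolding \<psi>_def using \<phi> X b
      by (intro linear_map_inv_into)
        (auto simp: chain_map_def sheaf_hom_def is_complex_def is_sheaf_def fd_space_subspace)
  next
    fix \<sigma> \<tau> w assume \<sigma>: "\<sigma> \<in> P" "\<tau> \<in> P" "\<sigma> \<le> \<tau>" "w \<in> stalk (obj Y d) \<sigma>"
    let ?v = "\<psi> d \<sigma> w"
    \<comment> \<open>Naturality of the inverse is tested after applying
      \<open>\<phi> d \<tau>\<close>, where it becomes naturality of \<phi>; injectivity then
      cancels. The differential is treated the same way below.\<close>
    have "\<phi> d \<tau> (res (obj X d) \<sigma> \<tau> ?v) = res (obj Y d) \<sigma> \<tau> w"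
      using \<phi> \<sigma> mem inv' by (auto simp: chain_map_def sheaf_hom_def)
    moreover have "res (obj X d) \<sigma> \<tau> ?v \<in> stalk (obj X d) \<tau>"
      using X \<sigma> mem res_mem unfolding is_complex_def by blast
    ultimately show "\<psi> d \<tau> (res (obj Y d) \<sigma> \<tau> w) = res (obj X d) \<sigma> \<tau> ?v"
      using inv \<sigma> by metis
  qed
  moreover have "\<psi> (d + 1) \<sigma> (diff Y d \<sigma> w) = diff X d \<sigma> (\<psi> d \<sigma> w)"
    if "\<sigma> \<in> P" "w \<in> stalk (obj Y d) \<sigma>" for d \<sigma> w
  proof -
    have "\<phi> (d + 1) \<sigma> (diff X d \<sigma> (\<psi> d \<sigma> w)) = diff Y d \<sigma> w"
      using \<phi> that mem inv' by (auto simp: chain_map_def)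
    moreover have "diff X d \<sigma> (\<psi> d \<sigma> w) \<in> stalk (obj X (d + 1)) \<sigma>"
      using X that mem sheaf_hom_mem unfolding is_complex_def by blast
    ultimately show ?thesis using inv that by metis
  qed
  ultimately have "chain_map P Y X \<psi>" by (auto simp: chain_map_def)
  then show ?thesis using X Y bij by (auto simp: complexes_isomorphic_def)
qed

lemma complexes_isomorphic_trans:
  assumes "complexes_isomorphic P X Y" "complexes_isomorphic P Y Z"
  shows "complexes_isomorphic P X Z"
proof -
  from assms(1) obtain \<phi> where \<phi>: "is_complex P X" "chain_map P X Y \<phi>"
    "\<And>d \<sigma>. \<sigma> \<in> P \<Longrightarrow> bij_betw (\<phi> d \<sigma>) (stalk (obj X d) \<sigma>) (stalk (obj Y d) \<sigma>)"
    by (auto simp: complexes_isomorphic_def)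
  from assms(2) obtain \<psi> where \<psi>: "is_complex P Z" "chain_map P Y Z \<psi>"
    "\<And>d \<sigma>. \<sigma> \<in> P \<Longrightarrow> bij_betw (\<psi> d \<sigma>) (stalk (obj Y d) \<sigma>) (stalk (obj Z d) \<sigma>)"
    by (auto simp: complexes_isomorphic_def)
  define \<chi> where "\<chi> d \<sigma> v = \<psi> d \<sigma> (\<phi> d \<sigma> v)" for d \<sigma> v
  have mem: "\<phi> d \<sigma> v \<in> stalk (obj Y d) \<sigma>" if "\<sigma> \<in> P" "v \<in> stalk (obj X d) \<sigma>" for d \<sigma> v
    using bij_betw_apply[OF \<phi>(3)] that by blast
  have "linear_map (stalk (obj X d) \<sigma>) (stalk (obj Z d) \<sigma>) (\<chi> d \<sigma>)" if "\<sigma> \<in> P" for d \<sigma>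
  proof -
    have "linear_map (stalk (obj X d) \<sigma>) (stalk (obj Y d) \<sigma>) (\<phi> d \<sigma>)"
      and "linear_map (stalk (obj Y d) \<sigma>) (stalk (obj Z d) \<sigma>) (\<psi> d \<sigma>)"
      using \<phi>(2) \<psi>(2) that by (simp_all add: chain_map_def sheaf_hom_def)
    from linear_map_compose[OF this] show ?thesis by (simp add: \<chi>_def[abs_def])
  qed
  then have "chain_map P X Z \<chi>"
    using \<phi>(2) \<psi>(2) mem by (simp add: chain_map_def sheaf_hom_def \<chi>_def)
  moreover have "bij_betw (\<chi> d \<sigma>) (stalk (obj X d) \<sigma>) (stalk (obj Z d) \<sigma>)" if "\<sigma> \<in> P" for d \<sigma>
    using bij_betw_trans[OF \<phi>(3) \<psi>(3)] that by (simp add: \<chi>_def[abs_def] o_def)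
  ultimately show ?thesis using \<phi>(1) \<psi>(1) by (auto simp: complexes_isomorphic_def)
qed

lemma bounded_complex_iso:
  assumes "complexes_isomorphic P X Y" "bounded_complex P X"
  shows "bounded_complex P Y"
proof -
  from assms(1) obtain \<phi> where Y: "is_complex P Y" and \<phi>: "chain_map P X Y \<phi>"
    and b: "\<And>d \<sigma>. \<sigma> \<in> P \<Longrightarrow> bij_betw (\<phi> d \<sigma>) (stalk (obj X d) \<sigma>) (stalk (obj Y d) \<sigma>)"
    by (auto simp: complexes_isomorphic_def)
  have "stalk (obj Y d) \<sigma> = {0}" if "\<sigma> \<in> P" "stalk (obj X d) \<sigma> = {0}" for d \<sigma>
  proof -
    \<comment> \<open>The bijection makes this stalk a singleton, and a singleton subspace is
      \<open>{0}\<close>.\<close>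
    have "stalk (obj Y d) \<sigma> = {\<phi> d \<sigma> 0}"
      using bij_betw_imp_surj_on[OF b[OF that(1), of d]] that(2) by simp
    moreover have "fun_space.subspace (stalk (obj Y d) \<sigma>)"
      using Y that(1) by (auto simp: is_complex_def is_sheaf_def fd_space_subspace)
    ultimately show ?thesis using fun_space.subspace_0 by fastforce
  qed
  then have "{d. \<exists>\<sigma>\<in>P. stalk (obj Y d) \<sigma> \<noteq> {0}} \<subseteq> {d. \<exists>\<sigma>\<in>P. stalk (obj X d) \<sigma> \<noteq> {0}}"
    by blast
  then show ?thesis
    using assms(2) Y by (auto simp: bounded_complex_def intro: finite_subset)
qed

text \<open>A zigzag from \<open>X\<close> begins with an isomorphism into index type
  \<open>nat\<close>; composing it with the given isomorphism or its inverse changes only this first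
  link.\<close>

lemma quasi_isomorphic_cong_iso:
  assumes "complexes_isomorphic P X Y"
  shows "quasi_isomorphic P X Z \<longleftrightarrow> quasi_isomorphic P Y Z"
  using assms bounded_complex_iso complexes_isomorphic_sym complexes_isomorphic_trans
  unfolding quasi_isomorphic_def by meson

section \<open>Represented complexes\<close>

lemma stalk_injective_sum:
  "v \<in> stalk (injective_sum ps) \<tau> \<longleftrightarrow> (\<forall>i. v i \<noteq> 0 \<longrightarrow> i < length ps \<and> \<tau> \<le> ps ! i)"
  by (simp add: injective_sum_def)

lemma res_injective_sum:
  "res (injective_sum ps) \<sigma> \<tau> v = (\<lambda>i. if i < length ps \<and> \<tau> \<le> ps ! i then v i else 0)"
  by (simp add: injective_sum_def fun_eq_iff)

lemma is_sheaf_injective_sum: "is_sheaf P (injective_sum ps :: ('p::order, nat, 'k::field) sheaf)"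
proof -
  have "fd_space (stalk (injective_sum ps :: ('p, nat, 'k) sheaf) \<sigma>)" for \<sigma>
    using fd_space_finite_support[of "{i. i < length ps \<and> \<sigma> \<le> ps ! i}"]
    by (simp add: injective_sum_def)
  then show ?thesis
    unfolding is_sheaf_def linear_map_def
    by (auto simp: stalk_injective_sum res_injective_sum fun_eq_iff fscale_apply dest: order_trans)
qed

text \<open>Otherwise \<open>\<tau> \<le> rs ! i \<le> cs ! j\<close>. This vanishing lets the index
  ranges in \<open>matrix_map\<close> be enlarged or cut down freely.\<close>

lemma labeled_matrix_zero:
  assumes "labeled_matrix P rs cs A" "i < length rs" "j < length cs"
    and "\<tau> \<le> rs ! i" "\<not> \<tau> \<le> cs ! j"
  shows "A $$ (i, j) = 0"
  using assms order_trans unfolding labeled_matrix_def by blast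

lemma sheaf_hom_matrix_map:
  fixes A :: "'k::field mat" and P :: "'p::order set"
  assumes "labeled_matrix P rs cs A"
  shows "sheaf_hom P (injective_sum cs) (injective_sum rs) (matrix_map rs cs A)"
  unfolding sheaf_hom_def
proof (intro conjI ballI impI)
  fix \<sigma>
  show "linear_map (stalk (injective_sum cs) \<sigma>) (stalk (injective_sum rs) \<sigma>) (matrix_map rs cs A \<sigma>)"
    by (auto simp: linear_map_def stalk_injective_sum matrix_map_def fun_eq_iff fscale_apply
        sum.distrib sum_distrib_left algebra_simps)
next
  fix \<sigma> \<tau> :: 'p and v :: "nat \<Rightarrow> 'k" assume le: "\<sigma> \<le> \<tau>"
  \<comment> \<open>Passing from \<tau> down to \<sigma> adds only columns whose label is not above
    \<tau>; these vanish in rows whose label is.\<close>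
  have "(\<Sum>j \<in> {j. j < length cs \<and> \<tau> \<le> cs ! j}. A $$ (i, j) * v j) =
      (\<Sum>j \<in> {j. j < length cs \<and> \<sigma> \<le> cs ! j}. A $$ (i, j) * v j)"
    if "i < length rs" "\<tau> \<le> rs ! i" for i
    using labeled_matrix_zero[OF assms] le that order_trans[OF le]
    by (intro sum.mono_neutral_left) auto
  then show "matrix_map rs cs A \<tau> (res (injective_sum cs) \<sigma> \<tau> v) =
      res (injective_sum rs) \<sigma> \<tau> (matrix_map rs cs A \<sigma> v)"
    using le by (auto simp: matrix_map_def res_injective_sum fun_eq_iff intro: order_trans)
qed

text \<open>The stalk at \<tau> sees only middle labels above \<tau>, whereas \<open>B * A\<close>
  sums over all of them; the surplus terms vanish because their factor from \<open>B\<close>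
  does.\<close>

lemma matrix_map_mult:
  assumes B: "labeled_matrix P rs ms B" and A: "labeled_matrix P ms cs A"
  shows "matrix_map rs ms B \<tau> (matrix_map ms cs A \<tau> v) = matrix_map rs cs (B * A) \<tau> v"
proof
  fix i
  let ?J = "{j. j < length ms \<and> \<tau> \<le> ms ! j}" and ?K = "{k. k < length cs \<and> \<tau> \<le> cs ! k}"
  show "matrix_map rs ms B \<tau> (matrix_map ms cs A \<tau> v) i = matrix_map rs cs (B * A) \<tau> v i"
  proof (cases "i < length rs \<and> \<tau> \<le> rs ! i")
    case True
    have entry: "(B * A) $$ (i, k) = (\<Sum>j\<in>?J. B $$ (i, j) * A $$ (j, k))" if "k \<in> ?K" for k
    proof -
      have "(B * A) $$ (i, k) = (\<Sum>j<length ms. B $$ (i, j) * A $$ (j, k))"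
        using True that A B
        by (auto simp: labeled_matrix_def scalar_prod_def atLeast0LessThan intro!: sum.cong)
      also have "\<dots> = (\<Sum>j\<in>?J. B $$ (i, j) * A $$ (j, k))"
        using True labeled_matrix_zero[OF B]
        by (intro sum.mono_neutral_right) auto
      finally show ?thesis .
    qed
    have "matrix_map rs ms B \<tau> (matrix_map ms cs A \<tau> v) i =
        (\<Sum>j\<in>?J. B $$ (i, j) * (\<Sum>k\<in>?K. A $$ (j, k) * v k))"
      using True by (simp add: matrix_map_def)
    also have "\<dots> = (\<Sum>j\<in>?J. \<Sum>k\<in>?K. B $$ (i, j) * A $$ (j, k) * v k)"
      by (simp add: sum_distrib_left mult.assoc)
    also have "\<dots> = (\<Sum>k\<in>?K. (\<Sum>j\<in>?J. B $$ (i, j) * A $$ (j, k)) * v k)"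
      by (subst sum.swap) (simp add: sum_distrib_right)
    also have "\<dots> = (\<Sum>k\<in>?K. (B * A) $$ (i, k) * v k)"
      using entry by simp
    also have "\<dots> = matrix_map rs cs (B * A) \<tau> v i"
      using True by (simp add: matrix_map_def)
    finally show ?thesis .
  qed (auto simp: matrix_map_def)
qed

lemma bounded_complex_represented:
  assumes "labeled_matrix_complex P M"
  shows "bounded_complex P (represented_complex M)"
proof -
  have lab: "labeled_matrix P (labels M (d + 1)) (labels M d) (matrices M d)"
    and zero: "matrices M (d + 1) * matrices M d =
      0\<^sub>m (length (labels M (d + 2))) (length (labels M d))" for d
    using assms by (auto simp: labeled_matrix_complex_def)
  have lab': "labeled_matrix P (labels M (d + 2)) (labels M (d + 1)) (matrices M (d + 1))" for d
    using lab[of "d + 1"] by (simp add: algebra_simps)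
  have "matrix_map (labels M (d + 2)) (labels M (d + 1)) (matrices M (d + 1)) \<tau>
      (matrix_map (labels M (d + 1)) (labels M d) (matrices M d) \<tau> v) = 0" for d \<tau> v
    unfolding matrix_map_mult[OF lab' lab] zero by (auto simp: matrix_map_def fun_eq_iff)
  then have "is_complex P (represented_complex M)"
    using sheaf_hom_matrix_map[OF lab]
    by (auto simp: is_complex_def represented_complex_def is_sheaf_injective_sum add.assoc)
  \<comment> \<open>An empty label list gives zero stalks, so nonzero degrees are among the finitely
    many with labels.\<close>
  moreover have "{d. \<exists>\<sigma>\<in>P. stalk (obj (represented_complex M) d) \<sigma> \<noteq> {0}} \<subseteq> {d. labels M d \<noteq> []}"
    by (auto simp: represented_complex_def injective_sum_def fun_eq_iff)
  ultimately show ?thesis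
    using assms by (auto simp: bounded_complex_def labeled_matrix_complex_def intro: finite_subset)
qed

text \<open>The matrices are untouched, so their products still vanish; monotonicity carries the
  order condition on nonzero entries to the new labels.\<close>

lemma labeled_matrix_complex_relabel:
  assumes "f ` P \<subseteq> L" "mono_on P f" "labeled_matrix_complex P M"
  shows "labeled_matrix_complex L (relabel f M)"
proof -
  have "labeled_matrix L (map f rs) (map f cs) A" if A: "labeled_matrix P rs cs A" for rs cs A
    unfolding labeled_matrix_def
  proof (intro conjI allI impI)
    show "set (map f rs) \<subseteq> L" "set (map f cs) \<subseteq> L"
      "A \<in> carrier_mat (length (map f rs)) (length (map f cs))"
      using A assms(1) by (auto simp: labeled_matrix_def)
    fix i j assume ij: "i < length (map f rs)" "j < length (map f cs)" "A $$ (i, j) \<noteq> 0"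
    then have "rs ! i \<in> P" "cs ! j \<in> P" "rs ! i \<le> cs ! j"
      using A by (auto simp: labeled_matrix_def)
    then show "map f rs ! i \<le> map f cs ! j"
      using mono_onD[OF assms(2)] ij by simp
  qed
  then show ?thesis
    using assms(3) by (auto simp: labeled_matrix_complex_def relabel_def)
qed

section \<open>Pushforward of injective sheaves\<close>

lemma stalk_pushforward:
  "s \<in> stalk (pushforward P f F) l \<longleftrightarrow>
     (\<forall>\<pi>\<in>star_preimage P f l. curry s \<pi> \<in> stalk F \<pi>) \<and>
     (\<forall>\<pi>\<in>star_preimage P f l. \<forall>\<rho>\<in>star_preimage P f l. \<pi> \<le> \<rho> \<longrightarrow>
        res F \<pi> \<rho> (curry s \<pi>) = curry s \<rho>) \<and>
     (\<forall>\<pi>. \<pi> \<notin> star_preimage P f l \<longrightarrow> curry s \<pi> = 0)"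
  by (simp add: pushforward_def)

lemma curry_res_pushforward:
  "curry (res (pushforward P f F) l l' s) \<pi> = (if \<pi> \<in> star_preimage P f l' then curry s \<pi> else 0)"
  by (auto simp: pushforward_def fun_eq_iff)

lemma curry_pushforward_map:
  "curry (pushforward_map P f \<phi> l s) \<pi> = (if \<pi> \<in> star_preimage P f l then \<phi> \<pi> (curry s \<pi>) else 0)"
  by (auto simp: pushforward_map_def fun_eq_iff)

lemma curry_add: "curry (s + t) \<pi> = curry s \<pi> + curry t \<pi>"
  by (simp add: fun_eq_iff)

lemma curry_fscale: "curry (fscale c s) \<pi> = fscale c (curry s \<pi>)"
  by (simp add: fun_eq_iff fscale_apply)

lemma curry_zero: "curry 0 \<pi> = 0"
  by (simp add: fun_eq_iff)

text \<open>Reduces equality of sections, stored as functions on pairs, to equality of the members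
  of the families.\<close>

lemma eq_curryI:
  assumes "\<And>\<pi>. curry s \<pi> = curry t \<pi>"
  shows "s = t"
  by (metis assms case_prod_curry ext)

lemma star_preimage_antimono: "l \<le> l' \<Longrightarrow> star_preimage P f l' \<subseteq> star_preimage P f l"
  by (auto simp: star_preimage_def)

lemma subspace_stalk_pushforward:
  assumes "is_sheaf P F"
  shows "fun_space.subspace (stalk (pushforward P f F) l)"
proof -
  have sub: "fun_space.subspace (stalk F \<pi>)" if "\<pi> \<in> star_preimage P f l" for \<pi>
    using assms that by (auto simp: is_sheaf_def star_preimage_def fd_space_subspace)
  have lin: "linear_map (stalk F \<pi>) (stalk F \<rho>) (res F \<pi> \<rho>)"
    if "\<pi> \<in> star_preimage P f l" "\<rho> \<in> star_preimage P f l" "\<pi> \<le> \<rho>" for \<pi> \<rho>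
    using assms that by (auto simp: is_sheaf_def star_preimage_def)
  show ?thesis
    unfolding fun_space.subspace_def
  proof (intro conjI ballI allI)
    show "0 \<in> stalk (pushforward P f F) l"
      using fun_space.subspace_0[OF sub] linear_map_zero[OF lin sub]
      by (simp add: stalk_pushforward curry_zero)
  next
    fix s t assume "s \<in> stalk (pushforward P f F) l" "t \<in> stalk (pushforward P f F) l"
    then show "s + t \<in> stalk (pushforward P f F) l"
      using fun_space.subspace_add[OF sub] linear_mapD(2)[OF lin]
      by (simp add: stalk_pushforward curry_add)
  next
    fix c s assume "s \<in> stalk (pushforward P f F) l"
    then show "fscale c s \<in> stalk (pushforward P f F) l"
      using fun_space.subspace_scale[OF sub] linear_mapD(3)[OF lin]
      by (simp add: stalk_pushforward curry_fscale)
  qed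
qed

text \<open>Star preimages shrink as \<open>l\<close> grows, and discarding members of a compatible
  family leaves a compatible family.\<close>

lemma linear_map_res_pushforward:
  assumes "l \<le> l'"
  shows "linear_map (stalk (pushforward P f F) l) (stalk (pushforward P f F) l')
    (res (pushforward P f F) l l')"
  using star_preimage_antimono[OF assms, of P f]
  unfolding linear_map_def
  by (auto simp: stalk_pushforward curry_res_pushforward curry_add curry_fscale subset_iff
      intro!: eq_curryI)

text \<open>Restrictions truncate families, hence compose. Finite-dimensionality is a premise here;
  for injective sheaves the coordinates below supply it.\<close>

lemma is_sheaf_pushforward:
  assumes "is_sheaf P F" and fd: "\<And>l. l \<in> L \<Longrightarrow> fd_space (stalk (pushforward P f F) l)"
  shows "is_sheaf L (pushforward P f F)"
  using linear_map_res_pushforward[of _ _ P f F] fd star_preimage_antimono[of _ _ P f]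
  unfolding is_sheaf_def
  by (auto simp: stalk_pushforward curry_res_pushforward subset_iff intro!: eq_curryI)

lemma sheaf_hom_pushforward_map:
  assumes \<phi>: "sheaf_hom P F G \<phi>"
    and F: "is_sheaf P F"
  shows "sheaf_hom L (pushforward P f F) (pushforward P f G) (pushforward_map P f \<phi>)"
proof -
  have lin: "linear_map (stalk F \<pi>) (stalk G \<pi>) (\<phi> \<pi>)" if "\<pi> \<in> star_preimage P f l" for \<pi> l
    using \<phi> that by (auto simp: sheaf_hom_def star_preimage_def)
  have nat: "\<phi> \<rho> (res F \<pi> \<rho> v) = res G \<pi> \<rho> (\<phi> \<pi> v)"
    if "\<pi> \<in> star_preimage P f l" "\<rho> \<in> star_preimage P f l" "\<pi> \<le> \<rho>" "v \<in> stalk F \<pi>" for \<pi> \<rho> l v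
    using \<phi> that by (auto simp: sheaf_hom_def star_preimage_def)
  show ?thesis
    unfolding sheaf_hom_def
  proof (intro conjI ballI impI)
    fix l
    have "pushforward_map P f \<phi> l s \<in> stalk (pushforward P f G) l"
      if "s \<in> stalk (pushforward P f F) l" for s
    proof -
      \<comment> \<open>Naturality of \<phi> turns compatibility of \<open>s\<close> into
        compatibility of the image family.\<close>
      have "res G \<pi> \<rho> (\<phi> \<pi> (curry s \<pi>)) = \<phi> \<rho> (curry s \<rho>)"
        if "\<pi> \<in> star_preimage P f l" "\<rho> \<in> star_preimage P f l" "\<pi> \<le> \<rho>" for \<pi> \<rho>
        using nat[OF that] \<open>s \<in> _\<close> that by (metis stalk_pushforward)
      then show ?thesis
        using that linear_mapD(1)[OF lin] by (simp add: stalk_pushforward curry_pushforward_map)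
    qed
    moreover have "pushforward_map P f \<phi> l (s + t) =
        pushforward_map P f \<phi> l s + pushforward_map P f \<phi> l t"
      if "s \<in> stalk (pushforward P f F) l" "t \<in> stalk (pushforward P f F) l" for s t
      using that linear_mapD(2)[OF lin]
      by (intro eq_curryI) (simp add: stalk_pushforward curry_pushforward_map curry_add)
    moreover have "pushforward_map P f \<phi> l (fscale c s) = fscale c (pushforward_map P f \<phi> l s)"
      if "s \<in> stalk (pushforward P f F) l" for c s
      using that linear_mapD(3)[OF lin]
      by (intro eq_curryI) (simp add: stalk_pushforward curry_pushforward_map curry_fscale)
    ultimately show "linear_map (stalk (pushforward P f F) l) (stalk (pushforward P f G) l)
        (pushforward_map P f \<phi> l)"
      by (auto simp: linear_map_def)
  next
    fix l l' s assume "l \<le> l'" "s \<in> stalk (pushforward P f F) l"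
    then show "pushforward_map P f \<phi> l' (res (pushforward P f F) l l' s) =
        res (pushforward P f G) l l' (pushforward_map P f \<phi> l s)"
      using star_preimage_antimono[of l l' P f]
      by (intro eq_curryI) (auto simp: curry_pushforward_map curry_res_pushforward)
  qed
qed

section \<open>Coordinates on the pushforward of an injective sheaf\<close>

definition pushforward_coords ::
    "('p \<Rightarrow> 'l::order) \<Rightarrow> 'p list \<Rightarrow> ('p, 'i, nat, 'k::field) sheaf_map \<Rightarrow>
     ('l, 'p \<times> 'i, nat, 'k) sheaf_map" where
  "pushforward_coords f ps \<phi> = (\<lambda>l s i.
     if i < length ps \<and> l \<le> f (ps ! i) then \<phi> (ps ! i) (curry s (ps ! i)) i else 0)"

text \<open>\<open>F\<close> is only isomorphic to an injective sum, so the isomorphism \<phi> is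
  part of the data, and coordinates are read after applying it.\<close>

locale injective_pushforward =
  fixes P :: "'p::order set" and f :: "'p \<Rightarrow> 'l::order" and F :: "('p, 'i, 'k::field) sheaf"
    and ps :: "'p list" and \<phi> :: "('p, 'i, nat, 'k) sheaf_map"
  assumes mono: "mono_on P f" and ps: "set ps \<subseteq> P" and F: "is_sheaf P F"
    and \<phi>: "sheaf_hom P F (injective_sum ps) \<phi>"
    and bij: "\<And>\<sigma>. \<sigma> \<in> P \<Longrightarrow> bij_betw (\<phi> \<sigma>) (stalk F \<sigma>) (stalk (injective_sum ps) \<sigma>)"
begin

lemma label_mem: "i < length ps \<Longrightarrow> ps ! i \<in> P"
  using ps by auto

lemma label_mem_star: "i < length ps \<Longrightarrow> l \<le> f (ps ! i) \<Longrightarrow> ps ! i \<in> star_preimage P f l"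
  by (simp add: star_preimage_def label_mem)

text \<open>Monotonicity gives \<open>l \<le> f \<pi> \<le> f (ps ! i)\<close>: a summand alive at a
  point of the star preimage is, once relabeled, alive at \<open>l\<close>.\<close>

lemma star_le_label:
  assumes "\<pi> \<in> star_preimage P f l" "i < length ps" "\<pi> \<le> ps ! i"
  shows "l \<le> f (ps ! i)"
proof -
  have "f \<pi> \<le> f (ps ! i)"
    using mono_onD[OF mono] assms label_mem by (auto simp: star_preimage_def)
  then show ?thesis using assms(1) by (auto simp: star_preimage_def)
qed

text \<open>Coordinate \<open>i\<close> survives restriction from \<pi> to \<open>ps ! i\<close>,
  where it is read off; compatibility of \<open>s\<close> and naturality of \<phi> identify the two
  values. So coordinates determine the family.\<close>

lemma family_eq_coords:
  assumes s: "s \<in> stalk (pushforward P f F) l" and \<pi>: "\<pi> \<in> star_preimage P f l"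
  shows "\<phi> \<pi> (curry s \<pi>) =
    (\<lambda>i. if i < length ps \<and> \<pi> \<le> ps ! i then pushforward_coords f ps \<phi> l s i else 0)"
proof
  fix i
  have P: "\<pi> \<in> P" and v: "curry s \<pi> \<in> stalk F \<pi>"
    using s \<pi> by (auto simp: stalk_pushforward star_preimage_def)
  show "\<phi> \<pi> (curry s \<pi>) i =
    (if i < length ps \<and> \<pi> \<le> ps ! i then pushforward_coords f ps \<phi> l s i else 0)"
  proof (cases "i < length ps \<and> \<pi> \<le> ps ! i")
    case True
    let ?\<rho> = "ps ! i"
    have le: "l \<le> f ?\<rho>" using star_le_label[OF \<pi>] True by blast
    have \<rho>: "?\<rho> \<in> star_preimage P f l" using True le label_mem_star by blast
    have "curry s ?\<rho> = res F \<pi> ?\<rho> (curry s \<pi>)"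
      using s \<pi> \<rho> True by (auto simp: stalk_pushforward)
    then have "\<phi> ?\<rho> (curry s ?\<rho>) = res (injective_sum ps) \<pi> ?\<rho> (\<phi> \<pi> (curry s \<pi>))"
      using \<phi> P v True label_mem by (auto simp: sheaf_hom_def)
    then show ?thesis
      using True le by (simp add: pushforward_coords_def res_injective_sum)
  next
    case False
    have "\<phi> \<pi> (curry s \<pi>) \<in> stalk (injective_sum ps) \<pi>"
      using sheaf_hom_mem[OF \<phi> P v] .
    then show ?thesis using False by (auto simp: stalk_injective_sum)
  qed
qed

lemma linear_map_coords:
  "linear_map (stalk (pushforward P f F) l) (stalk (injective_sum (map f ps)) l)
    (pushforward_coords f ps \<phi> l)"
proof -
  have lin: "linear_map (stalk F (ps ! i)) (stalk (injective_sum ps) (ps ! i)) (\<phi> (ps ! i))"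
    if "i < length ps" for i
    using \<phi> label_mem that by (auto simp: sheaf_hom_def)
  have mem: "curry s (ps ! i) \<in> stalk F (ps ! i)"
    if "s \<in> stalk (pushforward P f F) l" "i < length ps" "l \<le> f (ps ! i)" for s i
    using that label_mem_star by (auto simp: stalk_pushforward)
  have "pushforward_coords f ps \<phi> l s \<in> stalk (injective_sum (map f ps)) l" for s
    by (simp add: stalk_injective_sum pushforward_coords_def)
  moreover have "pushforward_coords f ps \<phi> l (s + t) =
      pushforward_coords f ps \<phi> l s + pushforward_coords f ps \<phi> l t"
    if "s \<in> stalk (pushforward P f F) l" "t \<in> stalk (pushforward P f F) l" for s t
    using that mem linear_mapD(2)[OF lin]
    by (simp add: pushforward_coords_def fun_eq_iff curry_add)
  moreover have "pushforward_coords f ps \<phi> l (fscale c s) =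
      fscale c (pushforward_coords f ps \<phi> l s)"
    if "s \<in> stalk (pushforward P f F) l" for c s
    using that mem linear_mapD(3)[OF lin]
    by (simp add: pushforward_coords_def fun_eq_iff curry_fscale fscale_apply)
  ultimately show ?thesis by (auto simp: linear_map_def)
qed

lemma bij_betw_coords:
  "bij_betw (pushforward_coords f ps \<phi> l) (stalk (pushforward P f F) l)
    (stalk (injective_sum (map f ps)) l)"
  unfolding bij_betw_def
proof
  show "inj_on (pushforward_coords f ps \<phi> l) (stalk (pushforward P f F) l)"
  proof (intro inj_onI eq_curryI)
    fix s t \<pi>
    assume s: "s \<in> stalk (pushforward P f F) l" and t: "t \<in> stalk (pushforward P f F) l"
      and eq: "pushforward_coords f ps \<phi> l s = pushforward_coords f ps \<phi> l t"
    show "curry s \<pi> = curry t \<pi>"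
    proof (cases "\<pi> \<in> star_preimage P f l")
      case True
      have "\<phi> \<pi> (curry s \<pi>) = \<phi> \<pi> (curry t \<pi>)"
        unfolding family_eq_coords[OF s True] family_eq_coords[OF t True] eq ..
      moreover have "inj_on (\<phi> \<pi>) (stalk F \<pi>)"
        using bij True by (auto simp: star_preimage_def bij_betw_def)
      ultimately show ?thesis
        using s t True by (auto simp: stalk_pushforward dest: inj_onD)
    qed (use s t in \<open>simp add: stalk_pushforward\<close>)
  qed
  show "pushforward_coords f ps \<phi> l ` stalk (pushforward P f F) l =
      stalk (injective_sum (map f ps)) l"
  proof
    show "pushforward_coords f ps \<phi> l ` stalk (pushforward P f F) l \<subseteq>
        stalk (injective_sum (map f ps)) l"
      using linear_mapD(1)[OF linear_map_coords] by blast
    show "stalk (injective_sum (map f ps)) l \<subseteq>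
        pushforward_coords f ps \<phi> l ` stalk (pushforward P f F) l"
    proof
      fix w :: "nat \<Rightarrow> 'k" assume w: "w \<in> stalk (injective_sum (map f ps)) l"
      \<comment> \<open>The preimage of \<open>w\<close> is built by reading
        \<open>family_eq_coords\<close> backwards: the member at \<pi> keeps the coordinates with
        label above \<pi>.\<close>
      define t where "t \<pi> i = (if i < length ps \<and> \<pi> \<le> ps ! i then w i else 0)" for \<pi> i
      have t: "t \<pi> \<in> stalk (injective_sum ps) \<pi>" for \<pi>
        by (simp add: t_def stalk_injective_sum)
      \<comment> \<open>\<phi> is inverted pointwise to land in \<open>F\<close>; the value 0 off
        the star preimage is the convention of \<open>pushforward\<close>.\<close>
      define s where "s = case_prod (\<lambda>\<pi>. if \<pi> \<in> star_preimage P f l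
        then inv_into (stalk F \<pi>) (\<phi> \<pi>) (t \<pi>) else 0)"
      have P: "\<pi> \<in> P" if "\<pi> \<in> star_preimage P f l" for \<pi>
        using that by (simp add: star_preimage_def)
      have s_mem: "curry s \<pi> \<in> stalk F \<pi>" and s_val: "\<phi> \<pi> (curry s \<pi>) = t \<pi>"
        if "\<pi> \<in> star_preimage P f l" for \<pi>
        using that bij[OF P[OF that]] t
        by (auto simp: s_def bij_betw_def inv_into_into f_inv_into_f)
      \<comment> \<open>Compatibility is tested after the injective \<open>\<phi> \<rho>\<close>,
        where it says that truncating \<open>t \<pi>\<close> gives \<open>t \<rho>\<close>.\<close>
      have "res F \<pi> \<rho> (curry s \<pi>) = curry s \<rho>"
        if \<pi>: "\<pi> \<in> star_preimage P f l" "\<rho> \<in> star_preimage P f l" "\<pi> \<le> \<rho>" for \<pi> \<rho>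
      proof -
        have "\<phi> \<rho> (res F \<pi> \<rho> (curry s \<pi>)) = res (injective_sum ps) \<pi> \<rho> (t \<pi>)"
          using \<phi> P s_mem s_val \<pi> by (auto simp: sheaf_hom_def)
        also have "\<dots> = t \<rho>"
          using \<pi>(3) by (auto simp: res_injective_sum t_def fun_eq_iff)
        finally have "\<phi> \<rho> (res F \<pi> \<rho> (curry s \<pi>)) = \<phi> \<rho> (curry s \<rho>)"
          using s_val \<pi> by simp
        moreover have "res F \<pi> \<rho> (curry s \<pi>) \<in> stalk F \<rho>"
          using res_mem[OF F] P s_mem \<pi> by blast
        ultimately show ?thesis
          using bij[OF P[OF \<pi>(2)]] s_mem[OF \<pi>(2)] by (auto simp: bij_betw_def dest: inj_onD)
      qed
      then have "s \<in> stalk (pushforward P f F) l"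
        using s_mem by (auto simp: stalk_pushforward) (auto simp: s_def fun_eq_iff)
      \<comment> \<open>At \<open>ps ! i\<close>, coordinate \<open>i\<close> of \<open>t\<close> is
        \<open>w i\<close> by reflexivity; all other entries of \<open>w\<close> vanish because
        \<open>w\<close> lies in the stalk.\<close>
      moreover have "w = pushforward_coords f ps \<phi> l s"
        using w s_val label_mem_star
        by (auto simp: pushforward_coords_def stalk_injective_sum t_def fun_eq_iff)
      ultimately show "w \<in> pushforward_coords f ps \<phi> l ` stalk (pushforward P f F) l"
        by blast
    qed
  qed
qed

text \<open>Each stalk is the image of a finite-dimensional stalk of an injective sum under the
  inverse of the coordinate map.\<close>

lemma is_sheaf_pushforward_injective: "is_sheaf L (pushforward P f F)"
proof (rule is_sheaf_pushforward[OF F])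
  fix l
  let ?W = "stalk (injective_sum (map f ps)) l :: (nat \<Rightarrow> 'k) set"
  let ?g = "inv_into (stalk (pushforward P f F) l) (pushforward_coords f ps \<phi> l)"
  have "fd_space ?W"
    using is_sheaf_injective_sum[of UNIV "map f ps"] by (auto simp: is_sheaf_def)
  moreover have "linear_map ?W (stalk (pushforward P f F) l) ?g"
    by (rule linear_map_inv_into[OF linear_map_coords subspace_stalk_pushforward[OF F]
          bij_betw_coords])
  ultimately have "fd_space (?g ` ?W)" by (rule fd_space_linear_image)
  then show "fd_space (stalk (pushforward P f F) l)"
    using bij_betw_imp_surj_on[OF bij_betw_inv_into[OF bij_betw_coords]] by simp
qed

text \<open>If \<open>l' \<le> f (ps ! i)\<close>, then \<open>ps ! i\<close> lies in the star
  preimage of \<open>l'\<close>, so truncation keeps the member there; all other coordinates are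
  zero on both sides.\<close>

lemma sheaf_hom_coords:
  "sheaf_hom L (pushforward P f F) (injective_sum (map f ps)) (pushforward_coords f ps \<phi>)"
  unfolding sheaf_hom_def
proof (intro conjI ballI impI linear_map_coords ext)
  fix l l' s i assume "l \<le> l'" "s \<in> stalk (pushforward P f F) l"
  then show "pushforward_coords f ps \<phi> l' (res (pushforward P f F) l l' s) i =
      res (injective_sum (map f ps)) l l' (pushforward_coords f ps \<phi> l s) i"
    using label_mem_star
    by (auto simp: pushforward_coords_def res_injective_sum curry_res_pushforward)
qed

end

text \<open>Where \<open>A\<close> has a nonzero entry, \<open>rs ! i \<le> cs ! j\<close>, so reading off the coordinate \<open>j\<close> at
  \<open>rs ! i\<close> or at \<open>cs ! j\<close> gives the same result.\<close>

lemma pushforward_coords_matrix_map: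
  assumes src: "injective_pushforward P f F cs \<phi>"
    and A: "labeled_matrix P rs cs A"
    and comm: "\<And>\<sigma> v. \<sigma> \<in> P \<Longrightarrow> v \<in> stalk F \<sigma> \<Longrightarrow> \<psi> \<sigma> (\<delta> \<sigma> v) = matrix_map rs cs A \<sigma> (\<phi> \<sigma> v)"
    and s: "s \<in> stalk (pushforward P f F) l"
  shows "pushforward_coords f rs \<psi> l (pushforward_map P f \<delta> l s) =
    matrix_map (map f rs) (map f cs) A l (pushforward_coords f cs \<phi> l s)"
proof
  fix i
  interpret injective_pushforward P f F cs \<phi> by (rule src)
  show "pushforward_coords f rs \<psi> l (pushforward_map P f \<delta> l s) i =
    matrix_map (map f rs) (map f cs) A l (pushforward_coords f cs \<phi> l s) i"
  proof (cases "i < length rs \<and> l \<le> f (rs ! i)")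
    case True
    let ?\<sigma> = "rs ! i" and ?c = "pushforward_coords f cs \<phi> l s"
    have P: "?\<sigma> \<in> P" using A True by (auto simp: labeled_matrix_def)
    then have \<sigma>: "?\<sigma> \<in> star_preimage P f l" using True by (simp add: star_preimage_def)
    have "pushforward_coords f rs \<psi> l (pushforward_map P f \<delta> l s) i = \<psi> ?\<sigma> (\<delta> ?\<sigma> (curry s ?\<sigma>)) i"
      using True \<sigma> by (simp add: pushforward_coords_def curry_pushforward_map)
    also have "\<dots> = matrix_map rs cs A ?\<sigma> (\<phi> ?\<sigma> (curry s ?\<sigma>)) i"
      using comm P s \<sigma> by (simp add: stalk_pushforward)
    \<comment> \<open>\<open>family_eq_coords\<close> at the row label eliminates \<phi> in favor of
      the coordinates at \<open>l\<close>.\<close>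
    also have "\<dots> = (\<Sum>j \<in> {j. j < length cs \<and> ?\<sigma> \<le> cs ! j}. A $$ (i, j) * ?c j)"
      using True by (simp add: matrix_map_def family_eq_coords[OF s \<sigma>])
    \<comment> \<open>By \<open>star_le_label\<close> the new range contains the old one; at the
      added columns the entry of \<open>A\<close> is zero.\<close>
    also have "\<dots> = (\<Sum>j \<in> {j. j < length cs \<and> l \<le> f (cs ! j)}. A $$ (i, j) * ?c j)"
      using A True star_le_label[OF \<sigma>] unfolding labeled_matrix_def
      by (intro sum.mono_neutral_left) auto
    also have "\<dots> = matrix_map (map f rs) (map f cs) A l ?c i"
      using True by (auto simp: matrix_map_def intro!: sum.cong)
    finally show ?thesis .
  qed (auto simp: pushforward_coords_def matrix_map_def)
qed

section \<open>Comparison of the pushforward with the relabeled complex, and the theorem\<close>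

lemma pushforward_isomorphic_relabel:
  assumes "f ` P \<subseteq> L" "mono_on P f" "represents P M X"
  shows "complexes_isomorphic L (pushforward_complex P f X) (represented_complex (relabel f M))"
proof -
  from assms(3) obtain \<phi> where M: "labeled_matrix_complex P M"
    and X: "is_complex P X"
    and \<phi>: "chain_map P X (represented_complex M) \<phi>"
    and bij: "\<And>d \<sigma>. \<sigma> \<in> P \<Longrightarrow>
      bij_betw (\<phi> d \<sigma>) (stalk (obj X d) \<sigma>) (stalk (injective_sum (labels M d)) \<sigma>)"
    by (auto simp: represents_def complexes_isomorphic_def represented_complex_def)
  have lab: "labeled_matrix P (labels M (d + 1)) (labels M d) (matrices M d)" for d
    using M by (auto simp: labeled_matrix_complex_def)
  have ip: "injective_pushforward P f (obj X d) (labels M d) (\<phi> d)" for d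
    using assms(2) lab[of d] X \<phi> bij
    by unfold_locales
      (auto simp: labeled_matrix_def is_complex_def chain_map_def represented_complex_def)
  let ?Y = "pushforward_complex P f X" and ?R = "represented_complex (relabel f M)"
  have hom: "sheaf_hom P (obj X d) (obj X (d + 1)) (diff X d)" for d
    using X by (simp add: is_complex_def)
  \<comment> \<open>Differentials act on each member of a family, so this is inherited from
    \<open>X\<close>; off the star preimage the values are zero by definition.\<close>
  have "diff ?Y (d + 1) l (diff ?Y d l s) = 0" if "s \<in> stalk (obj ?Y d) l" for d l s
    using that X
    by (intro eq_curryI)
      (auto simp: pushforward_complex_def curry_pushforward_map stalk_pushforward is_complex_def
        curry_zero star_preimage_def)
  then have Y: "is_complex L ?Y"
    using injective_pushforward.is_sheaf_pushforward_injective[OF ip]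
      sheaf_hom_pushforward_map[OF hom] X
    by (auto simp: is_complex_def pushforward_complex_def)
  have R: "is_complex L ?R"
    using bounded_complex_represented[OF labeled_matrix_complex_relabel[OF assms(1,2) M]]
    by (simp add: bounded_complex_def)
  let ?\<Phi> = "\<lambda>d. pushforward_coords f (labels M d) (\<phi> d)"
  have nat: "\<phi> (d + 1) \<sigma> (diff X d \<sigma> v) =
      matrix_map (labels M (d + 1)) (labels M d) (matrices M d) \<sigma> (\<phi> d \<sigma> v)"
    if "\<sigma> \<in> P" "v \<in> stalk (obj X d) \<sigma>" for d \<sigma> v
    using \<phi> that by (auto simp: chain_map_def represented_complex_def)
  \<comment> \<open>The coordinate maps turn the pushed-forward differential into the same matrix
    with new labels.\<close>
  have comm: "?\<Phi> (d + 1) l (diff ?Y d l s) = diff ?R d l (?\<Phi> d l s)"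
    if "s \<in> stalk (pushforward P f (obj X d)) l" for d l s
    using pushforward_coords_matrix_map[where \<psi> = "\<phi> (d + 1)" and \<delta> = "diff X d",
        OF ip[of d] lab[of d] nat that]
    by (simp add: pushforward_complex_def represented_complex_def relabel_def)
  have "chain_map L ?Y ?R ?\<Phi>"
    using injective_pushforward.sheaf_hom_coords[OF ip] comm
    by (auto simp: chain_map_def pushforward_complex_def represented_complex_def relabel_def)
  moreover have "bij_betw (?\<Phi> d l) (stalk (obj ?Y d) l) (stalk (obj ?R d) l)" for d l
    using injective_pushforward.bij_betw_coords[OF ip]
    by (simp add: pushforward_complex_def represented_complex_def relabel_def)
  ultimately show ?thesis
    using Y R by (auto simp: complexes_isomorphic_def)
qed

theorem proposition5p17:
  fixes P :: "'p::order set" and L :: "'l::order set" and f :: "'p \<Rightarrow> 'l"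
    and I :: "('p, 'i, 'k::field) sheaf_complex" and M :: "('p, 'k) matrix_complex"
  assumes "finite P" and "finite L" and "f ` P \<subseteq> L" and "mono_on P f"
    and "injective_complex P I" and "represents P M I"
  shows "labeled_matrix_complex L (relabel f M) \<and>
    (\<forall>J :: ('l, 'j, 'k) sheaf_complex.
       minimal_injective_resolution L (pushforward_complex P f I) J \<longleftrightarrow>
       minimal_injective_complex L J \<and>
       quasi_isomorphic L (represented_complex (relabel f M)) J)"
proof -
  have "labeled_matrix_complex L (relabel f M)"
    using labeled_matrix_complex_relabel assms(3,4,6) by (auto simp: represents_def)
  \<comment> \<open>Minimality concerns \<open>J\<close> alone, so it remains to exchange the first
    argument of \<open>quasi_isomorphic\<close> along the isomorphism.\<close>
  then show ?thesis
    unfolding minimal_injective_resolution_def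
    using quasi_isomorphic_cong_iso[OF pushforward_isomorphic_relabel[OF assms(3,4,6)]]
    by blast
qed

end
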